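(* Let $0<r<1$ be a real number and let $n>1$ be an integer, with exactly $k$ distinct prime factors, such that $r+\sigma^{-1}(n)<1$. Then $L(n)<k/r$ and $g(n)\le\lceil k/r\rceil$.
   Context: For an integer $n>1$, let $k=\omega(n)$ be the number of distinct primes dividing $n$, and let $q_1<q_2<\dots<q_k$ be these primes. Define $\sigma^{-1}(n)=\sum_{i=1}^k 1/q_i$ (the superscript $-1$ is part of the name, not an exponent or inverse). Jacobsthal's function $g(n)$ is the smallest positive integer $m$ such that for every integer $a$ the set $\{a+1,\dots,a+m\}$ contains an integer coprime to $n$. $L(n)$ is the largest integer $l$ such that there is a set of $l$ consecutive integers $\{b+1,\dots,b+l\}$ with $\gcd(b+j,n)>1$ for every $1\le j\le l$. *)

theory Defs
  imports Complex_Main "HOL-Computational_Algebra.Primes"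
begin

definition omega :: "nat \<Rightarrow> nat" where
  "omega n = card (prime_factors n)"

definition sigma_inv :: "nat \<Rightarrow> real" where
  "sigma_inv n = (\<Sum>q\<in>prime_factors n. 1 / real q)"

definition jacobsthal_g :: "nat \<Rightarrow> nat" where
  "jacobsthal_g n =
     (LEAST m. m > 0 \<and> (\<forall>a::int. \<exists>x\<in>{a + 1..a + int m}. coprime x (int n)))"

(* l = 0 is admissible (the empty run), so the maximum is over a nonempty set. *)
definition jacobsthal_L :: "nat \<Rightarrow> nat" where
  "jacobsthal_L n =
     (GREATEST l. \<exists>b::int. \<forall>j\<in>{1..l}. gcd (b + int j) (int n) > 1)"

(* The next facts show that the LEAST and GREATEST above are attained. *)

lemma coprime_in_interval:
  fixes a :: int and n :: nat
  assumes "n > 0"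
  shows "\<exists>x\<in>{a + 1..a + int n}. coprime x (int n)"
proof
  let ?x = "a + 1 + (- a) mod int n"
  show "?x \<in> {a + 1..a + int n}"
    using assms pos_mod_bound[of "int n" "- a"] pos_mod_sign[of "int n" "- a"]
    unfolding atLeastAtMost_iff by linarith
  have "?x = int n * (- ((- a) div int n)) + 1"
    using mult_div_mod_eq[of "int n" "- a"] by (simp add: algebra_simps)
  then show "coprime ?x (int n)"
    by (metis coprime_commute coprime_1_right gcd_add_mult coprime_iff_gcd_eq_1
        mult.commute)
qed

lemma jacobsthal_g_attained:
  assumes "n > 0"
  shows "jacobsthal_g n > 0 \<and>
    (\<forall>a::int. \<exists>x\<in>{a + 1..a + int (jacobsthal_g n)}. coprime x (int n))"
  unfolding jacobsthal_g_def
  by (rule LeastI[where k = n]) (use assms coprime_in_interval in blast)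

lemma jacobsthal_L_attained:
  assumes "n > 0"
  shows "\<exists>b::int. \<forall>j\<in>{1..jacobsthal_L n}. gcd (b + int j) (int n) > 1"
    and "(\<exists>b::int. \<forall>j\<in>{1..l}. gcd (b + int j) (int n) > 1) \<Longrightarrow> l \<le> jacobsthal_L n"
proof -
  let ?P = "\<lambda>l. \<exists>b::int. \<forall>j\<in>{1..l}. gcd (b + int j) (int n) > 1"
  have bound: "l \<le> n" if "?P l" for l
  proof (rule ccontr)
    assume "\<not> l \<le> n"
    from that obtain b :: int where b: "\<forall>j\<in>{1..l}. gcd (b + int j) (int n) > 1" by blast
    obtain x where x: "x \<in> {b + 1..b + int n}" "coprime x (int n)"
      using coprime_in_interval[OF assms] by blast
    have "nat (x - b) \<in> {1..l}" "b + int (nat (x - b)) = x"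
      using x(1) \<open>\<not> l \<le> n\<close> by auto
    with b have "gcd x (int n) > 1" by metis
    with x(2) show False by simp
  qed
  show "?P (jacobsthal_L n)"
    unfolding jacobsthal_L_def by (rule GreatestI_nat[where P = ?P and k = 0 and b = n]) (simp, blast intro: bound)
  show "?P l \<Longrightarrow> l \<le> jacobsthal_L n"
    unfolding jacobsthal_L_def by (rule Greatest_le_nat[where b = n]) (use bound in blast)+
qed

end

theory Submission
  imports Defs
begin

text \<open>A run of \<open>l\<close> consecutive integers meets the multiples of a prime \<open>q\<close> at most
  \<open>\<lceil>l / q\<rceil> \<le> l / q + 1 - 1 / q\<close> times. If no member of the run is coprime to \<open>n\<close>,
  then every member is a multiple of one of the \<open>k\<close> primes dividing \<open>n\<close>, so summing over
  these primes gives \<open>l \<le> l * \<sigma> + k - \<sigma>\<close> with \<open>\<sigma> = \<Sum> 1 / q\<close>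
  (\<open>noncoprime_run_bound\<close>). As \<open>0 < \<sigma> < 1 - r\<close>, it follows that
  \<open>l * r \<le> l * (1 - \<sigma>) \<le> k - \<sigma> < k\<close>, which bounds \<open>L(n)\<close>. The bound on
  \<open>g(n)\<close> is the same fact read contrapositively: a run whose length is at least \<open>k / r\<close>
  is too long to avoid the integers coprime to \<open>n\<close>.\<close>

text \<open>The multiples \<open>q * t\<close> in the run have quotients \<open>t\<close> between
  \<open>b div q + 1\<close> and \<open>(b + l) div q\<close>, and the two roundings together lose at most
  \<open>q - 1\<close>. The saving of \<open>1\<close> against \<open>q\<close>
  becomes the term \<open>- \<sigma>\<close>, which keeps the bound on the run length strict even for
  the empty run.\<close>

lemma card_multiples_in_run:
  fixes b :: int and q l :: nat
  assumes "q > 0"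
  shows "card {j \<in> {1..l}. int q dvd b + int j} * q \<le> l + q - 1"
proof -
  let ?M = "{j \<in> {1..l}. int q dvd b + int j}"
  let ?u = "(b + int l) div int q" and ?d = "b div int q"
  have q: "int q > 0" using assms by simp
  have "card ?M \<le> card {?d + 1..?u}"
  proof (rule card_inj_on_le[where f = "\<lambda>j. (b + int j) div int q"])
    show "inj_on (\<lambda>j. (b + int j) div int q) ?M"
    proof (rule inj_onI)
      fix i j
      assume i: "i \<in> ?M" and j: "j \<in> ?M"
        and eq: "(b + int i) div int q = (b + int j) div int q"
      have "b + int i = (b + int i) div int q * int q" using i by simp
      also have "\<dots> = b + int j" unfolding eq using j by simp
      finally show "i = j" by simp
    qed
    show "(\<lambda>j. (b + int j) div int q) ` ?M \<subseteq> {?d + 1..?u}"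
    proof (rule image_subsetI)
      fix j assume j: "j \<in> ?M"
      then obtain t where t: "b + int j = int q * t" by auto
      have "?d < t"
      proof (rule ccontr)
        assume "\<not> ?d < t"
        then have "int q * t \<le> int q * ?d" using q by simp
        also have "\<dots> \<le> b"
          using mult_div_mod_eq[of "int q" b] pos_mod_sign[OF q, of b] by linarith
        finally show False using t j by simp
      qed
      moreover have "(b + int j) div int q \<le> ?u"
        using j q by (intro zdiv_mono1) auto
      ultimately show "(b + int j) div int q \<in> {?d + 1..?u}" using t q by simp
    qed
  qed simp
  \<comment> \<open>The floors are monotone, so truncation to \<open>nat\<close> in the cardinality is harmless.\<close>
  moreover have "?d \<le> ?u" using q by (intro zdiv_mono1) auto
  ultimately have "int (card ?M) \<le> ?u - ?d" by simp
  then have "int (card ?M) * int q \<le> (?u - ?d) * int q" using q by simp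
  also have "\<dots> = int q * ?u - int q * ?d" by (simp add: algebra_simps)
  also have "\<dots> \<le> int l + int q - 1"
    using mult_div_mod_eq[of "int q" b] pos_mod_bound[OF q, of b]
      mult_div_mod_eq[of "int q" "b + int l"] pos_mod_sign[OF q, of "b + int l"]
    by linarith
  finally have "int (card ?M * q) \<le> int l + int q - 1" by simp
  then show ?thesis using assms by linarith
qed

lemma noncoprime_run_bound:
  fixes b :: int and n l :: nat
  assumes "n > 0" and run: "\<forall>j\<in>{1..l}. gcd (b + int j) (int n) > 1"
  shows "real l \<le> real l * sigma_inv n + real (omega n) - sigma_inv n"
proof -
  let ?M = "\<lambda>q. {j \<in> {1..l}. int q dvd b + int j}"
  have cover: "{1..l} \<subseteq> (\<Union>q\<in>prime_factors n. ?M q)"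
  proof
    fix j assume j: "j \<in> {1..l}"
    let ?g = "nat (gcd (b + int j) (int n))"
    have g: "int ?g = gcd (b + int j) (int n)" by simp
    have "?g \<noteq> 1" using run j g by force
    then obtain q where q: "prime q" "q dvd ?g" using prime_factor_nat by blast
    from q(2) have "int q dvd int ?g" by (simp only: of_nat_dvd_iff)
    then have "int q dvd gcd (b + int j) (int n)" unfolding g .
    then have "int q dvd b + int j" "q dvd n" by simp_all
    with q j show "j \<in> (\<Union>q\<in>prime_factors n. ?M q)"
      using assms(1) by (auto simp: prime_factors_dvd)
  qed
  have "l = card {1..l}" by simp
  also have "\<dots> \<le> card (\<Union>q\<in>prime_factors n. ?M q)"
    using cover by (intro card_mono) auto
  also have "\<dots> \<le> (\<Sum>q\<in>prime_factors n. card (?M q))"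
    by (rule card_UN_le) simp
  finally have "real l \<le> real (\<Sum>q\<in>prime_factors n. card (?M q))"
    by (rule of_nat_mono)
  also have "\<dots> = (\<Sum>q\<in>prime_factors n. real (card (?M q)))"
    by (rule of_nat_sum)
  also have "\<dots> \<le> (\<Sum>q\<in>prime_factors n. real l * (1 / real q) + 1 - 1 / real q)"
  proof (rule sum_mono)
    fix q assume "q \<in> prime_factors n"
    then have q: "q > 0" by (auto intro: prime_gt_0_nat)
    have "real (card (?M q) * q) \<le> real (l + q - 1)"
      using card_multiples_in_run[OF q, of l b] by (rule of_nat_mono)
    then have "real (card (?M q)) * real q \<le> real l + real q - 1"
      using q by (simp add: of_nat_diff)
    then have "real (card (?M q)) \<le> (real l + real q - 1) / real q"
      using q by (simp add: pos_le_divide_eq)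
    also have "\<dots> = real l * (1 / real q) + 1 - 1 / real q"
      using q by (simp add: add_divide_distrib diff_divide_distrib)
    finally show "real (card (?M q)) \<le> real l * (1 / real q) + 1 - 1 / real q" .
  qed
  also have "\<dots> = real l * sigma_inv n + real (omega n) - sigma_inv n"
    unfolding sigma_inv_def omega_def sum_distrib_left sum_subtractf sum.distrib by simp
  finally show ?thesis .
qed

lemma sigma_inv_pos:
  assumes "n > 1"
  shows "sigma_inv n > 0"
proof -
  obtain p where "prime p" "p dvd n" using prime_factor_nat[of n] assms by auto
  then have "prime_factors n \<noteq> {}" using assms by (auto simp: prime_factors_dvd)
  then show ?thesis
    unfolding sigma_inv_def by (intro sum_pos) (auto intro: prime_gt_0_nat)
qed

theorem mainTheorem4:
  fixes r :: real and n k :: nat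
  assumes "0 < r" and "r < 1"
    and "n > 1"
    and "omega n = k"
    and "r + sigma_inv n < 1"
  shows "real (jacobsthal_L n) < real k / r \<and> int (jacobsthal_g n) \<le> \<lceil>real k / r\<rceil>"
proof -
  have short: "real l < real k / r"
    if "\<forall>j\<in>{1..l}. gcd (b + int j) (int n) > 1" for l and b :: int
  proof -
    have "real l * r \<le> real l * (1 - sigma_inv n)"
      using assms(5) by (intro mult_left_mono) auto
    also have "\<dots> \<le> real k - sigma_inv n"
      using noncoprime_run_bound[OF _ that] assms(3,4) by (simp add: algebra_simps)
    also have "\<dots> < real k" using sigma_inv_pos[OF assms(3)] by simp
    finally show ?thesis using assms(1) by (simp add: field_simps)
  qed
  have "real (jacobsthal_L n) < real k / r"
    using jacobsthal_L_attained(1)[of n] assms(3) short by auto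
  moreover have "int (jacobsthal_g n) \<le> \<lceil>real k / r\<rceil>"
  proof -
    define m where "m = nat \<lceil>real k / r\<rceil>"
    \<comment> \<open>The strict bound for the empty run gives \<open>k / r > 0\<close>, which makes \<open>m\<close> positive.\<close>
    have pos: "0 < real k / r" using short[of 0 0] by simp
    then have m: "int m = \<lceil>real k / r\<rceil>" by (simp add: m_def)
    then have m_ge: "real k / r \<le> real m" by linarith
    have "\<exists>x\<in>{a + 1..a + int m}. coprime x (int n)" for a :: int
    proof (rule ccontr)
      assume none: "\<not> ?thesis"
      have "gcd (a + int j) (int n) > 1" if "j \<in> {1..m}" for j
      proof -
        have "\<not> coprime (a + int j) (int n)" using none that by auto
        then have "gcd (a + int j) (int n) \<noteq> 1" by (simp add: coprime_iff_gcd_eq_1)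
        moreover have "gcd (a + int j) (int n) > 0" using assms(3) by simp
        ultimately show ?thesis by linarith
      qed
      then have "real m < real k / r" using short by blast
      with m_ge show False by simp
    qed
    moreover have "m > 0" using pos m_ge by linarith
    ultimately have "jacobsthal_g n \<le> m"
      unfolding jacobsthal_g_def by (intro Least_le) blast
    with m show ?thesis by simp
  qed
  ultimately show ?thesis ..
qed

end
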